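(* Let $d\geq 0$ and $k\geq 1$ be integers. Every graph $G$ with $\operatorname{mad}(G)<\frac{2d+2}{d+2}\, k$ is $k$-choosable with defect $d$.
   Context: Graphs are finite and simple. The maximum average degree $\operatorname{mad}(G)$ of a graph $G$ is the maximum, over all subgraphs $H$ of $G$, of the average degree of $H$. A colouring of $G$ assigns a colour to each vertex; the monochromatic subgraph is the spanning subgraph consisting of the edges whose endpoints receive the same colour. A colouring has defect $d$ if the monochromatic subgraph has maximum degree at most $d$. A list-assignment $L$ assigns a set $L(v)$ of colours to each vertex $v$; it is a $k$-list-assignment if $|L(v)|\geq k$ for every $v$. An $L$-colouring is a colouring in which each vertex $v$ receives a colour from $L(v)$. $G$ is $k$-choosable with defect $d$ if for every $k$-list-assignment $L$ of $G$, $G$ has an $L$-colouring with defect $d$. *)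

theory Defs
  imports Complex_Main "Graph_Theory.Graph_Theory"
begin

text \<open>
  A finite simple graph is a \<^locale>\<open>pair_graph\<close>: finite, loop-free, and with a symmetric set of
  arcs, so that an undirected edge \<open>uv\<close> is the pair of arcs \<open>(u, v)\<close>, \<open>(v, u)\<close>. The number of edges
  at a vertex is therefore its \<^const>\<open>out_degree\<close>. The library's \<^const>\<open>subgraph\<close> only asks for a
  subdigraph; a subgraph in the undirected sense has to be a \<^locale>\<open>pair_graph\<close> as well.
\<close>

definition average_degree :: "'a pair_pre_digraph \<Rightarrow> real" where
  "average_degree G = (\<Sum>v\<in>pverts G. real (out_degree G v)) / real (card (pverts G))"

text \<open>
  The subgraph without vertices is not excluded: its average degree is \<open>0 / 0 = 0\<close>, which does not
  affect the maximum when \<open>G\<close> has a vertex, and gives the graph without vertices the value \<open>0\<close>.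
\<close>

definition mad :: "'a pair_pre_digraph \<Rightarrow> real" where
  "mad G = Max {average_degree H | H. pair_graph H \<and> subgraph H G}"

definition monochromatic_subgraph ::
    "'a pair_pre_digraph \<Rightarrow> ('a \<Rightarrow> 'c) \<Rightarrow> 'a pair_pre_digraph" where
  "monochromatic_subgraph G f =
     \<lparr> pverts = pverts G, parcs = {(u, v). (u, v) \<in> parcs G \<and> f u = f v} \<rparr>"

definition has_defect :: "'a pair_pre_digraph \<Rightarrow> ('a \<Rightarrow> 'c) \<Rightarrow> nat \<Rightarrow> bool" where
  "has_defect G f d \<longleftrightarrow> (\<forall>v\<in>pverts G. out_degree (monochromatic_subgraph G f) v \<le> d)"

text \<open>
  Lists may be infinite; since \<^const>\<open>card\<close> is \<open>0\<close> on infinite sets, these need a separate disjunct.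
\<close>

definition list_assignment :: "'a pair_pre_digraph \<Rightarrow> nat \<Rightarrow> ('a \<Rightarrow> 'c set) \<Rightarrow> bool" where
  "list_assignment G k L \<longleftrightarrow> (\<forall>v\<in>pverts G. infinite (L v) \<or> k \<le> card (L v))"

definition list_colouring :: "'a pair_pre_digraph \<Rightarrow> ('a \<Rightarrow> 'c set) \<Rightarrow> ('a \<Rightarrow> 'c) \<Rightarrow> bool" where
  "list_colouring G L f \<longleftrightarrow> (\<forall>v\<in>pverts G. f v \<in> L v)"

text \<open>
  A definition cannot quantify over types, so the type of colours is an explicit parameter;
  a statement about all lists leaves it as a type variable.
\<close>

definition choosable_with_defect ::
    "'c itself \<Rightarrow> nat \<Rightarrow> nat \<Rightarrow> 'a pair_pre_digraph \<Rightarrow> bool" where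
  "choosable_with_defect _ k d G \<longleftrightarrow>
     (\<forall>L :: 'a \<Rightarrow> 'c set. list_assignment G k L \<longrightarrow>
        (\<exists>f. list_colouring G L f \<and> has_defect G f d))"

text \<open>The maximum in \<^const>\<open>mad\<close> is taken over a nonempty finite set.\<close>

lemma finite_average_degrees:
  assumes "pair_graph G"
  shows "finite {average_degree H | H. pair_graph H \<and> subgraph H G}"
proof -
  interpret pair_graph G by fact
  have "finite ((\<lambda>(V, A). \<lparr> pverts = V, parcs = A \<rparr>) ` (Pow (pverts G) \<times> Pow (parcs G)))"
    (is "finite ?S")
    using pair_finite_verts pair_finite_arcs by simp
  moreover have "H \<in> ?S" if "subgraph H G" for H :: "'a pair_pre_digraph"
    using that by (intro image_eqI[where x = "(pverts H, parcs H)"]) (auto simp: subgraph_def)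
  ultimately have "finite {H :: 'a pair_pre_digraph. pair_graph H \<and> subgraph H G}"
    by (blast intro: finite_subset)
  then show ?thesis by simp
qed

lemma average_degree_le_mad:
  assumes "pair_graph G" "pair_graph H" "subgraph H G"
  shows "average_degree H \<le> mad G"
  unfolding mad_def using assms by (intro Max_ge finite_average_degrees) auto

lemma mad_attained:
  assumes "pair_graph G"
  shows "\<exists>H. pair_graph H \<and> subgraph H G \<and> average_degree H = mad G"
proof -
  interpret pair_graph G by fact
  have "subgraph G G" by (auto simp: subgraph_def compatible_def wf_digraph)
  then have "mad G \<in> {average_degree H | H. pair_graph H \<and> subgraph H G}"
    unfolding mad_def using assms by (intro Max_in finite_average_degrees) auto
  then show ?thesis by auto
qed

lemma monochromatic_subgraph:
  assumes "pair_graph G"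
  shows "pair_graph (monochromatic_subgraph G f)" "spanning (monochromatic_subgraph G f) G"
proof -
  interpret pair_graph G by fact
  have sub: "parcs (monochromatic_subgraph G f) \<subseteq> parcs G"
    by (auto simp: monochromatic_subgraph_def)
  show *: "pair_graph (monochromatic_subgraph G f)"
  proof
    show "symmetric (monochromatic_subgraph G f)"
      using pair_sym_arcs by (auto simp: symmetric_def sym_def monochromatic_subgraph_def)
    show "finite (parcs (monochromatic_subgraph G f))"
      using sub pair_finite_arcs by (rule finite_subset)
  qed (use pair_finite_verts in \<open>auto simp: monochromatic_subgraph_def dest: in_arcsD1 in_arcsD2 pair_no_loops\<close>)
  then interpret M: pair_graph "monochromatic_subgraph G f" .
  show "spanning (monochromatic_subgraph G f) G"
    using sub wf_digraph M.wf_digraph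
    by (simp add: spanning_def subgraph_def compatible_def monochromatic_subgraph_def)
qed

end

theory Submission
  imports Defs
begin

text \<open>
  Colour the induced subgraphs of \<open>G\<close> by induction on their vertex sets \<open>S\<close>. Suppose that some
  nonempty \<open>T \<subseteq> S\<close> satisfies \<open>deg\<^sub>T v < (d + 1) (k - deg\<^sub>S v + deg\<^sub>T v)\<close> for all \<open>v \<in> T\<close>. Colour
  \<open>S - T\<close> inductively and remove from each list in \<open>T\<close> the colours of the neighbours outside \<open>T\<close>. As
  in Lovasz's argument, a colouring of \<open>T\<close> from the remaining lists with the fewest monochromatic
  edges has defect \<open>d\<close>, because a vertex with more than \<open>d\<close> neighbours in every available colour
  would have too many neighbours in \<open>T\<close>.

  If no such \<open>T\<close> exists, let \<open>A\<close> be the set of vertices of degree less than \<open>(d + 1) k\<close> in \<open>S\<close> and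
  let \<open>B = S - A\<close>. Deleting the vertices of \<open>A\<close> one at a time, always one that violates the
  inequality, and adding up gives \<open>(d + 1) k |A| \<le> (d + 1) e(A, B) + (d + 2) e(A)\<close>. Together with
  \<open>(d + 1) k |B| \<le> e(A, B) + 2 e(B)\<close> this shows that \<open>S\<close> induces a subgraph of average degree at least
  \<open>(2 d + 2) k / (d + 2)\<close>.
\<close>

section \<open>Degrees and edge counts in sets of pairs\<close>

definition degree_in :: "('a \<times> 'a) set \<Rightarrow> 'a set \<Rightarrow> 'a \<Rightarrow> nat" where
  "degree_in E S v = card {u \<in> S. (v, u) \<in> E}"

text \<open>If \<open>E\<close> is symmetric and irreflexive, \<open>degree_sum E X X\<close> counts
  every edge inside \<open>X\<close> twice, while for disjoint \<open>X\<close> and \<open>Y\<close>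
  \<open>degree_sum E X Y\<close> counts every edge between them once.\<close>

definition degree_sum :: "('a \<times> 'a) set \<Rightarrow> 'a set \<Rightarrow> 'a set \<Rightarrow> nat" where
  "degree_sum E X Y = (\<Sum>v\<in>X. degree_in E Y v)"

lemma degree_in_eq_sum:
  "finite S \<Longrightarrow> degree_in E S v = (\<Sum>u\<in>S. of_bool ((v, u) \<in> E))"
  by (simp add: degree_in_def sum.If_cases of_bool_def Int_def)

lemma degree_in_Un:
  assumes "finite X" "finite Y" "X \<inter> Y = {}"
  shows "degree_in E (X \<union> Y) v = degree_in E X v + degree_in E Y v"
  using assms by (simp add: degree_in_eq_sum sum.union_disjoint del: sum_of_bool_eq)

lemma degree_sum_Un_left:
  assumes "finite X" "finite Y" "X \<inter> Y = {}"
  shows "degree_sum E (X \<union> Y) Z = degree_sum E X Z + degree_sum E Y Z"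
  using assms by (simp add: degree_sum_def sum.union_disjoint)

lemma degree_sum_Un_right:
  assumes "finite X" "finite Y" "X \<inter> Y = {}"
  shows "degree_sum E Z (X \<union> Y) = degree_sum E Z X + degree_sum E Z Y"
  using assms by (simp add: degree_sum_def degree_in_Un sum.distrib)

lemma degree_sum_commute:
  assumes "sym E" "finite X" "finite Y"
  shows "degree_sum E X Y = degree_sum E Y X"
proof -
  have "(v, u) \<in> E \<longleftrightarrow> (u, v) \<in> E" for u v
    using assms(1) by (auto simp: sym_def)
  then show ?thesis
    unfolding degree_sum_def using assms(2,3) by (simp add: degree_in_eq_sum sum.swap[of _ Y] del: sum_of_bool_eq)
qed

lemma degree_sum_insert:
  assumes "sym E" "irrefl E" "finite T" "v \<notin> T"
  shows "degree_sum E (insert v T) (insert v T) = degree_sum E T T + 2 * degree_in E T v"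
proof -
  have "degree_sum E {v} {v} = 0"
    using assms(2) by (simp add: degree_sum_def degree_in_eq_sum irrefl_def)
  moreover have "degree_sum E {v} T = degree_in E T v"
    by (simp add: degree_sum_def)
  ultimately show ?thesis
    using assms degree_sum_Un_left[of "{v}" T E "insert v T"]
      degree_sum_Un_right[of "{v}" T E "{v}"] degree_sum_Un_right[of "{v}" T E T]
      degree_sum_commute[of E "{v}" T]
    by simp
qed

section \<open>Minimising monochromatic edges\<close>

definition monochromatic :: "('a \<times> 'a) set \<Rightarrow> ('a \<Rightarrow> 'c) \<Rightarrow> ('a \<times> 'a) set" where
  "monochromatic E f = {(u, v) \<in> E. f u = f v}"

lemma sym_monochromatic: "sym E \<Longrightarrow> sym (monochromatic E f)"
  by (auto simp: monochromatic_def sym_def)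

lemma irrefl_monochromatic: "irrefl E \<Longrightarrow> irrefl (monochromatic E f)"
  by (auto simp: monochromatic_def irrefl_def)

lemma degree_in_monochromatic_cong:
  assumes "\<And>u. u \<in> insert v S \<Longrightarrow> f u = g u"
  shows "degree_in (monochromatic E f) S v = degree_in (monochromatic E g) S v"
  using assms by (auto simp: degree_in_def monochromatic_def intro!: arg_cong[where f = card])

text \<open>Pigeonhole: the colour classes among the neighbours of \<open>v\<close> are disjoint, so
  \<open>d + 1\<close> neighbours in each colour of \<open>C\<close> would exceed the
  degree.\<close>

lemma ex_rare_colour:
  assumes "finite S" "finite C" "degree_in E S v < (d + 1) * card C"
  shows "\<exists>c\<in>C. card {u \<in> S. (v, u) \<in> E \<and> f u = c} \<le> d"
proof (rule ccontr)
  assume "\<not> ?thesis"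
  then have "(\<Sum>c\<in>C. d + 1) \<le> (\<Sum>c\<in>C. card {u \<in> S. (v, u) \<in> E \<and> f u = c})"
    by (intro sum_mono) force
  also have "\<dots> = card (\<Union>c\<in>C. {u \<in> S. (v, u) \<in> E \<and> f u = c})"
    using assms by (intro card_UN_disjoint[symmetric]) auto
  also have "\<dots> \<le> degree_in E S v"
    unfolding degree_in_def using assms by (intro card_mono) auto
  finally show False
    using assms(3) by (simp add: mult.commute)
qed

lemma list_colouring_of_small_degree:
  fixes L :: "'a \<Rightarrow> 'c set"
  assumes "sym E" "irrefl E" "finite T"
    and fin: "\<And>v. v \<in> T \<Longrightarrow> finite (L v)"
    and deg: "\<And>v. v \<in> T \<Longrightarrow> degree_in E T v < (d + 1) * card (L v)"
  shows "\<exists>f. \<forall>v\<in>T. f v \<in> L v \<and> degree_in (monochromatic E f) T v \<le> d"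
proof -
  define P where "P f \<longleftrightarrow> (\<forall>v\<in>T. f v \<in> L v)" for f
  \<comment> \<open>Twice the number of monochromatic edges inside \<open>T\<close>.\<close>
  define M where "M f = degree_sum (monochromatic E f) T T" for f :: "'a \<Rightarrow> 'c"
  have "\<exists>c. c \<in> L v" if "v \<in> T" for v
    using deg[OF that] by (cases "L v = {}") auto
  then have "\<exists>f. P f"
    unfolding P_def by metis
  then obtain f where f: "P f" and min: "\<And>g. P g \<Longrightarrow> M f \<le> M g"
    using ex_has_least_nat[of P _ M] by blast
  have "degree_in (monochromatic E f) T v \<le> d" if v: "v \<in> T" for v
  proof -
    obtain c where c: "c \<in> L v" "card {u \<in> T. (v, u) \<in> E \<and> f u = c} \<le> d"
      using ex_rare_colour[OF \<open>finite T\<close> fin deg] v by metis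
    define g where "g = f(v := c)"
    define R where "R = T - {v}"
    have R: "finite R" "v \<notin> R" "T = insert v R"
      using v \<open>finite T\<close> by (auto simp: R_def)
    have "P g"
      using f c v by (auto simp: P_def g_def)
    \<comment> \<open>Recolouring \<open>v\<close> leaves the first summand unchanged, so minimality
      of \<open>M f\<close> only compares the monochromatic degrees of \<open>v\<close> under
      \<open>f\<close> and \<open>g\<close>.\<close>
    have M: "M h = degree_sum (monochromatic E h) R R + 2 * degree_in (monochromatic E h) R v" for h
      unfolding M_def R(3) using R assms(1,2)
      by (intro degree_sum_insert sym_monochromatic irrefl_monochromatic)
    have "degree_sum (monochromatic E f) R R = degree_sum (monochromatic E g) R R"
      unfolding degree_sum_def using R
      by (intro sum.cong degree_in_monochromatic_cong) (auto simp: g_def)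
    then have "degree_in (monochromatic E f) R v \<le> degree_in (monochromatic E g) R v"
      using min[OF \<open>P g\<close>] M[of f] M[of g] by simp
    also have "\<dots> \<le> card {u \<in> T. (v, u) \<in> E \<and> f u = c}"
      unfolding degree_in_def using R \<open>finite T\<close>
      by (intro card_mono) (auto simp: g_def monochromatic_def)
    finally have "degree_in (monochromatic E f) R v \<le> d"
      using c by simp
    moreover have "degree_in (monochromatic E f) T v = degree_in (monochromatic E f) R v"
      unfolding degree_in_def R(3) using \<open>irrefl E\<close>
      by (auto simp: monochromatic_def irrefl_def intro!: arg_cong[where f = card])
    ultimately show ?thesis by simp
  qed
  then show ?thesis
    using f by (auto simp: P_def)
qed

section \<open>Choosing the vertices to colour last, and the induction\<close>

text \<open>
  The condition on \<open>T\<close> is \<open>deg\<^sub>T v < (d + 1) (k - deg\<^sub>S v + deg\<^sub>T v)\<close>, rearranged to avoid subtraction.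
\<close>

lemma ex_small_degree_subset:
  fixes d k :: nat
  assumes "sym E" "irrefl E" "finite S"
    and sparse: "(d + 2) * degree_sum E S S < (2 * d + 2) * k * card S"
  shows "\<exists>T\<subseteq>S. T \<noteq> {} \<and>
    (\<forall>v\<in>T. (d + 1) * degree_in E S v < (d + 1) * k + d * degree_in E T v)"
proof (rule ccontr)
  assume "\<not> ?thesis"
  then have violating: "\<exists>v\<in>T. (d + 1) * k + d * degree_in E T v \<le> (d + 1) * degree_in E S v"
    if "T \<subseteq> S" "T \<noteq> {}" for T
    using that by (meson not_less)
  define A where "A = {v \<in> S. degree_in E S v < (d + 1) * k}"
  define B where "B = S - A"
  have S: "S = A \<union> B" "A \<inter> B = {}" "finite A" "finite B"
    using \<open>finite S\<close> by (auto simp: A_def B_def)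
  \<comment> \<open>Sum of the violated inequalities over the vertices of \<open>T\<close> as they
    are removed: each edge inside \<open>T\<close> is counted when its first end goes. Everything is
    doubled because \<open>degree_sum E T T\<close> counts edges twice.\<close>
  have peel: "2 * (d + 1) * k * card T + d * degree_sum E T T \<le> 2 * (d + 1) * degree_sum E T S"
    if "T \<subseteq> S" for T
    using that
  proof (induction "card T" arbitrary: T)
    case 0
    then have "T = {}"
      using \<open>finite S\<close> by (simp add: finite_subset)
    then show ?case by (simp add: degree_sum_def)
  next
    case (Suc n)
    then have "T \<noteq> {}" by auto
    then obtain v where v: "v \<in> T"
      and le: "(d + 1) * k + d * degree_in E T v \<le> (d + 1) * degree_in E S v"
      using violating Suc.prems by blast
    define R where "R = T - {v}"
    have R: "finite R" "v \<notin> R" "T = insert v R"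
      using v finite_subset[OF Suc.prems \<open>finite S\<close>] by (auto simp: R_def)
    have "2 * (d + 1) * k * card R + d * degree_sum E R R \<le> 2 * (d + 1) * degree_sum E R S"
      using Suc R by auto
    moreover have "degree_in E T v = degree_in E R v"
      unfolding degree_in_def R(3) using \<open>irrefl E\<close>
      by (auto simp: irrefl_def intro!: arg_cong[where f = card])
    moreover have "degree_sum E T S = degree_in E S v + degree_sum E R S"
      using R by (simp add: degree_sum_def)
    moreover have "degree_sum E T T = degree_sum E R R + 2 * degree_in E R v"
      using R degree_sum_insert assms(1,2) by metis
    moreover have "card T = Suc (card R)"
      using R by simp
    ultimately show ?case
      using le by (simp add: algebra_simps)
  qed
  have A: "2 * (d + 1) * k * card A + d * degree_sum E A A \<le>
      2 * (d + 1) * (degree_sum E A A + degree_sum E A B)"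
    using peel[of A] S degree_sum_Un_right[of A B E A] by auto
  have "(\<Sum>v\<in>B. (d + 1) * k) \<le> degree_sum E B S"
    unfolding degree_sum_def by (intro sum_mono) (auto simp: A_def B_def)
  then have B: "(d + 1) * k * card B \<le> degree_sum E A B + degree_sum E B B"
    using S degree_sum_Un_right[of A B E B] degree_sum_commute[OF \<open>sym E\<close>, of A B]
    by (simp add: mult.commute)
  have "degree_sum E S S = degree_sum E A A + 2 * degree_sum E A B + degree_sum E B B"
    using S degree_sum_Un_left[of A B E S] degree_sum_Un_right[of A B E A]
      degree_sum_Un_right[of A B E B] degree_sum_commute[OF \<open>sym E\<close>, of A B] by simp
  moreover have "card S = card A + card B"
    using S by (simp add: card_Un_disjoint)
  \<comment> \<open>Adding twice \<open>B\<close> to \<open>A\<close> gives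
    \<open>degree_sum E A B\<close> the coefficient \<open>2 * (d + 1) + 2 = 2 * (d + 2)\<close>,
    and \<open>degree_sum E B B\<close> the coefficient \<open>2\<close>, at most
    \<open>d + 2\<close>; this contradicts \<open>sparse\<close>.\<close>
  ultimately show False
    using A B sparse by (simp add: algebra_simps)
qed

text \<open>Sparseness is assumed for all nonempty subsets, so it is inherited by the smaller set
  \<open>U\<close> that is coloured first.\<close>

lemma defective_colouring_of_sparse:
  fixes d k :: nat and L :: "'a \<Rightarrow> 'c set"
  assumes "sym E" "irrefl E" "finite S"
    and sparse: "\<And>T. T \<subseteq> S \<Longrightarrow> T \<noteq> {} \<Longrightarrow>
      (d + 2) * degree_sum E T T < (2 * d + 2) * k * card T"
    and fin: "\<And>v. v \<in> S \<Longrightarrow> finite (L v)"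
    and card: "\<And>v. v \<in> S \<Longrightarrow> card (L v) = k"
  shows "\<exists>f. \<forall>v\<in>S. f v \<in> L v \<and> degree_in (monochromatic E f) S v \<le> d"
  using assms(3-)
proof (induction S rule: finite_psubset_induct)
  case (psubset S)
  show ?case
  proof (cases "S = {}")
    case False
    then obtain T where T: "T \<subseteq> S" "T \<noteq> {}"
      and small: "\<And>v. v \<in> T \<Longrightarrow>
        (d + 1) * degree_in E S v < (d + 1) * k + d * degree_in E T v"
      using ex_small_degree_subset[OF assms(1,2) \<open>finite S\<close>, of d k] psubset.prems(1) by blast
    define U where "U = S - T"
    have U: "U \<subset> S" "finite U" "finite T" "S = T \<union> U" "T \<inter> U = {}"
      using T \<open>finite S\<close> by (auto simp: U_def finite_subset)
    have "\<exists>g. \<forall>v\<in>U. g v \<in> L v \<and> degree_in (monochromatic E g) U v \<le> d"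
      using U by (intro psubset.IH psubset.prems) auto
    then obtain g where g: "\<And>v. v \<in> U \<Longrightarrow> g v \<in> L v"
        "\<And>v. v \<in> U \<Longrightarrow> degree_in (monochromatic E g) U v \<le> d"
      by blast
    \<comment> \<open>With these lists no edge between \<open>T\<close> and \<open>U\<close> becomes
      monochromatic, so the defects on the two sides do not add up.\<close>
    define L' where "L' v = L v - g ` {u \<in> U. (v, u) \<in> E}" for v
    have "degree_in E T v < (d + 1) * card (L' v)" if v: "v \<in> T" for v
    proof -
      have "card (g ` {u \<in> U. (v, u) \<in> E}) \<le> degree_in E U v"
        unfolding degree_in_def using U by (intro card_image_le) auto
      moreover have "k - card (g ` {u \<in> U. (v, u) \<in> E}) \<le> card (L' v)"
        unfolding L'_def using U diff_card_le_card_Diff[of "g ` {u \<in> U. (v, u) \<in> E}" "L v"]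
          psubset.prems(3) T v by auto
      ultimately have "k \<le> card (L' v) + degree_in E U v"
        by linarith
      \<comment> \<open>As degrees in \<open>S\<close> split over \<open>T\<close> and
        \<open>U\<close>, \<open>small\<close> says that
        \<open>degree_in E T v + (d + 1) * degree_in E U v < (d + 1) * k\<close>; the terms for
        \<open>U\<close> cancel.\<close>
      then have "(d + 1) * k \<le> (d + 1) * card (L' v) + (d + 1) * degree_in E U v"
        by (metis add_mult_distrib2 mult_le_mono2)
      then show ?thesis
        using small[OF v] degree_in_Un[OF U(3,2,5), of E v] U(4) by (simp add: algebra_simps)
    qed
    moreover have "finite (L' v)" if "v \<in> T" for v
      using that T psubset.prems(2) by (auto simp: L'_def)
    ultimately obtain h where h: "\<And>v. v \<in> T \<Longrightarrow> h v \<in> L' v"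
        "\<And>v. v \<in> T \<Longrightarrow> degree_in (monochromatic E h) T v \<le> d"
      using list_colouring_of_small_degree[OF assms(1,2) \<open>finite T\<close>, of L' d] by blast
    define f where "f v = (if v \<in> T then h v else g v)" for v
    have no_mono: "f u \<noteq> f v" if "u \<in> T" "v \<in> U" "(u, v) \<in> E" for u v
      using h(1)[OF that(1)] that U by (auto simp: f_def L'_def)
    have "f v \<in> L v \<and> degree_in (monochromatic E f) S v \<le> d" if "v \<in> S" for v
    proof (cases "v \<in> T")
      case True
      have "degree_in (monochromatic E f) S v = degree_in (monochromatic E f) T v"
        unfolding degree_in_def using True U no_mono
        by (intro arg_cong[where f = card]) (force simp: monochromatic_def)
      also have "\<dots> = degree_in (monochromatic E h) T v"
        using True by (intro degree_in_monochromatic_cong) (auto simp: f_def)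
      finally show ?thesis
        using h(1)[OF True] h(2)[OF True] True by (simp add: f_def L'_def)
    next
      case False
      then have "v \<in> U"
        using that by (simp add: U_def)
      have "f u \<noteq> f v" if "u \<in> T" "(v, u) \<in> E" for u
        using no_mono[OF that(1) \<open>v \<in> U\<close>] that \<open>sym E\<close> by (auto dest: symD)
      then have "degree_in (monochromatic E f) S v = degree_in (monochromatic E f) U v"
        unfolding degree_in_def U(4)
        by (intro arg_cong[where f = card]) (force simp: monochromatic_def)
      also have "\<dots> = degree_in (monochromatic E g) U v"
        using \<open>v \<in> U\<close> U by (intro degree_in_monochromatic_cong) (auto simp: f_def)
      finally show ?thesis
        using g \<open>v \<in> U\<close> False by (simp add: f_def)
    qed
    then show ?thesis by blast
  qed simp
qed

section \<open>From sets of pairs back to graphs\<close>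

lemma pair_out_degree_eq_degree_in:
  assumes "pair_wf_digraph H"
  shows "out_degree H v = degree_in (parcs H) (pverts H) v"
proof -
  have "out_arcs H v = Pair v ` {u \<in> pverts H. (v, u) \<in> parcs H}"
    using pair_wf_digraph.in_arcsD2[OF assms] by (auto simp: out_arcs_def)
  then show ?thesis
    by (simp add: out_degree_def degree_in_def card_image inj_on_def)
qed

text \<open>The quotient is the average degree of the subgraph induced by \<open>T\<close>, also for
  empty \<open>T\<close>, where both are \<open>0 / 0 = 0\<close>.\<close>

lemma average_degree_induced_le_mad:
  assumes "pair_graph G" "T \<subseteq> pverts G"
  shows "real (degree_sum (parcs G) T T) / real (card T) \<le> mad G"
proof -
  interpret pair_graph G by fact
  define H where "H = \<lparr> pverts = T, parcs = parcs G \<inter> T \<times> T \<rparr>"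
  have H: "pair_graph H"
  proof
    show "symmetric H"
      using pair_sym_arcs by (auto simp: symmetric_def sym_def H_def)
  qed (use finite_subset[OF assms(2) pair_finite_verts] pair_finite_arcs
      in \<open>auto simp: H_def dest: pair_no_loops\<close>)
  then interpret H: pair_graph H .
  have "subgraph H G"
    using assms(2) wf_digraph H.wf_digraph by (auto simp: subgraph_def compatible_def H_def)
  moreover have "out_degree H v = degree_in (parcs G) T v" if "v \<in> T" for v
    using that pair_out_degree_eq_degree_in[of H v] H.pair_wf_digraph_axioms
    by (auto simp: H_def degree_in_def intro!: arg_cong[where f = card])
  then have "average_degree H = real (degree_sum (parcs G) T T) / real (card T)"
    by (simp add: average_degree_def degree_sum_def H_def)
  ultimately show ?thesis
    using average_degree_le_mad[OF assms(1) H] by simp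
qed

lemma out_degree_monochromatic_subgraph:
  assumes "pair_graph G"
  shows "out_degree (monochromatic_subgraph G f) v =
    degree_in (monochromatic (parcs G) f) (pverts G) v"
proof -
  interpret M: pair_graph "monochromatic_subgraph G f"
    using assms by (rule monochromatic_subgraph)
  show ?thesis
    using pair_out_degree_eq_degree_in[OF M.pair_wf_digraph_axioms]
    by (simp add: monochromatic_subgraph_def monochromatic_def case_prod_unfold)
qed

theorem theorem2:
  fixes d k :: nat and G :: "'a pair_pre_digraph"
  assumes "k \<ge> 1"
    and "pair_graph G"
    and "mad G < (2 * real d + 2) / (real d + 2) * real k"
  shows "choosable_with_defect TYPE('c) k d G"
  unfolding choosable_with_defect_def
proof (intro allI impI)
  fix L :: "'a \<Rightarrow> 'c set"
  assume L: "list_assignment G k L"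
  interpret pair_graph G by fact
  \<comment> \<open>Lists may be infinite or too long; cutting them to exactly \<open>k\<close>
    colours makes \<open>card\<close> meaningful.\<close>
  have "\<exists>C\<subseteq>L v. finite C \<and> card C = k" if "v \<in> pverts G" for v
    using L that unfolding list_assignment_def
    by (metis infinite_arbitrarily_large obtain_subset_with_card_n)
  then obtain L' where L': "\<And>v. v \<in> pverts G \<Longrightarrow> L' v \<subseteq> L v \<and> finite (L' v) \<and> card (L' v) = k"
    by metis
  have sym: "sym (parcs G)"
    using pair_sym_arcs by (simp add: symmetric_def)
  have irrefl: "irrefl (parcs G)"
    by (auto simp: irrefl_def dest: pair_no_loops)
  \<comment> \<open>Clearing denominators; for empty \<open>T\<close> the strict inequality would
    read \<open>0 < 0\<close>.\<close>
  have sparse: "(d + 2) * degree_sum (parcs G) T T < (2 * d + 2) * k * card T"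
    if "T \<subseteq> pverts G" "T \<noteq> {}" for T
  proof -
    have "card T > 0"
      using that pair_finite_verts by (simp add: card_gt_0_iff finite_subset)
    moreover have "real (degree_sum (parcs G) T T) / real (card T)
        < (2 * real d + 2) * real k / (real d + 2)"
      using average_degree_induced_le_mad[OF assms(2) that(1)] assms(3) by simp
    ultimately have "real (degree_sum (parcs G) T T) * (real d + 2)
        < (2 * real d + 2) * real k * real (card T)"
      by (simp add: divide_less_eq less_divide_eq mult.commute mult.left_commute)
    then have "real ((d + 2) * degree_sum (parcs G) T T) < real ((2 * d + 2) * k * card T)"
      by (simp add: algebra_simps)
    then show ?thesis
      by (simp only: of_nat_less_iff)
  qed
  obtain f where "\<forall>v\<in>pverts G. f v \<in> L' v \<and>
      degree_in (monochromatic (parcs G) f) (pverts G) v \<le> d"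
    using defective_colouring_of_sparse[OF sym irrefl pair_finite_verts sparse, of L'] L' by blast
  then have "list_colouring G L f \<and> has_defect G f d"
    using L' by (auto simp: list_colouring_def has_defect_def
        out_degree_monochromatic_subgraph[OF assms(2)])
  then show "\<exists>f. list_colouring G L f \<and> has_defect G f d" by blast
qed

end
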